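(* Let $d\ge 1$ and $x\ge d+1$ be integers. Let $\mathcal{F}$ be a family of nonempty compact convex sets in $\mathbb{R}^d$, and suppose that for every subfamily $\mathcal{F}'\subseteq\mathcal{F}$ of cardinality $x$ the inequality $P(\mathcal{F}')<\lceil x/d\rceil$ holds; i.e., $\mathcal{F}'$ can be pierced by fewer than $x/d$ points. Then $P(\mathcal{F})\le M(x,d+1;d)$.
   Context: For integers $p\ge q$, a family of sets has the $(p,q)$ property if among any $p$ members of the family some $q$ have a nonempty intersection. A family $\mathcal{H}$ of sets is $k$-pierceable if it can be split into $k$ or fewer subfamilies, each having a nonempty intersection (for nonempty sets in $\mathbb{R}^d$: if there is a set of at most $k$ points meeting every member of $\mathcal{H}$). The piercing number $P(\mathcal{H})$ is the minimum $k$ such that $\mathcal{H}$ is $k$-pierceable, with $P(\mathcal{H})=\infty$ if no such finite $k$ exists. For $p\ge q\ge d+1$, $M(p,q;d)$ denotes the maximum possible (possibly infinite) piercing number of a family of nonempty compact convex sets in $\mathbb{R}^d$ with the $(p,q)$ property. *)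

theory Defs
  imports "HOL-Analysis.Analysis" "HOL-Library.Disjoint_Sets" "HOL-Library.Extended_Nat"
begin

definition pq_property :: "nat \<Rightarrow> nat \<Rightarrow> 'a set set \<Rightarrow> bool" where
  "pq_property p q H \<longleftrightarrow>
     (\<forall>G\<subseteq>H. finite G \<and> card G = p \<longrightarrow>
       (\<exists>G'\<subseteq>G. finite G' \<and> card G' = q \<and> \<Inter>G' \<noteq> {}))"

definition pierceable :: "nat \<Rightarrow> 'a set set \<Rightarrow> bool" where
  "pierceable k H \<longleftrightarrow>
     (\<exists>\<P>. partition_on H \<P> \<and> finite \<P> \<and> card \<P> \<le> k \<and> (\<forall>G\<in>\<P>. \<Inter>G \<noteq> {}))"

text \<open>The infimum of the empty set in \<^typ>\<open>enat\<close> is \<^term>\<open>\<infinity> :: enat\<close>, the value for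
  families that are not pierceable by finitely many points.\<close>

definition piercing_number :: "'a set set \<Rightarrow> enat" where
  "piercing_number H = (INF k\<in>{k. pierceable k H}. enat k)"

definition compact_convex_family :: "'a::euclidean_space set set \<Rightarrow> bool" where
  "compact_convex_family H \<longleftrightarrow> (\<forall>S\<in>H. S \<noteq> {} \<and> compact S \<and> convex S)"

text \<open>\<open>max_piercing p q TYPE('n)\<close> is $M(p,q;d)$ for $d$ = \<open>CARD('n)\<close>. A supremum in
  \<^typ>\<open>enat\<close> of a nonempty set is its maximum, or \<^term>\<open>\<infinity> :: enat\<close> if the set has no finite bound.\<close>

definition max_piercing :: "nat \<Rightarrow> nat \<Rightarrow> 'n::finite itself \<Rightarrow> enat" where
  "max_piercing p q _ =
     (SUP H\<in>{H :: (real ^ 'n) set set. compact_convex_family H \<and> pq_property p q H}.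
        piercing_number H)"

lemma pierceable_iff_points:
  "pierceable k H \<longleftrightarrow> (\<exists>A. finite A \<and> card A \<le> k \<and> (\<forall>S\<in>H. S \<inter> A \<noteq> {}))"
proof
  assume "pierceable k H"
  then obtain P where P: "partition_on H P" "finite P" "card P \<le> k" "\<forall>G\<in>P. \<Inter>G \<noteq> {}"
    unfolding pierceable_def by blast
  then have "\<forall>G\<in>P. \<exists>a. a \<in> \<Inter>G"
    by (simp only: ex_in_conv)
  then obtain f where f: "\<forall>G\<in>P. f G \<in> \<Inter>G"
    by (rule bchoice[THEN exE])
  have "finite (f ` P)" "card (f ` P) \<le> k"
    using P card_image_le[OF P(2), of f] by auto
  moreover have "\<forall>S\<in>H. S \<inter> f ` P \<noteq> {}"
    using f partition_onD1[OF P(1)] by fastforce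
  ultimately show "\<exists>A. finite A \<and> card A \<le> k \<and> (\<forall>S\<in>H. S \<inter> A \<noteq> {})"
    by blast
next
  assume "\<exists>A. finite A \<and> card A \<le> k \<and> (\<forall>S\<in>H. S \<inter> A \<noteq> {})"
  then obtain A where A: "finite A" "card A \<le> k" "\<forall>S\<in>H. S \<inter> A \<noteq> {}"
    by blast
  from A(3) have "\<forall>S\<in>H. \<exists>a. a \<in> S \<inter> A"
    by (simp only: ex_in_conv)
  then obtain g where g: "\<forall>S\<in>H. g S \<in> S \<inter> A"
    by (rule bchoice[THEN exE])
  define P where "P = (\<lambda>a. {S\<in>H. g S = a}) ` (g ` H)"
  have gA: "g ` H \<subseteq> A"
    using g by blast
  have "partition_on H P"
    unfolding P_def by (rule partition_onI) (auto simp: disjnt_def)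
  moreover have "finite P"
    unfolding P_def using gA A(1) finite_subset by blast
  moreover have "card P \<le> k"
    unfolding P_def using card_image_le[OF finite_subset[OF gA A(1)]] card_mono[OF A(1) gA] A(2)
    by (meson le_trans)
  moreover have "\<forall>G\<in>P. \<Inter>G \<noteq> {}"
  proof
    fix G assume "G \<in> P"
    then obtain a where "G = {S\<in>H. g S = a}"
      unfolding P_def by blast
    then have "a \<in> \<Inter>G"
      using g by blast
    then show "\<Inter>G \<noteq> {}"
      by blast
  qed
  ultimately show "pierceable k H"
    unfolding pierceable_def by blast
qed

end

theory Submission
  imports Defs
begin

text \<open>Write d for \<open>CARD('n)\<close>. The hypothesis forces \<open>F\<close> to have the
  (x, d+1) property, so \<open>F\<close> is one of the families over which M(x, d+1; d) is the
  supremum. The reason is pigeonhole: if x sets are pierced by k < x/d points, then k*d < x, so one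
  of the points lies in at least d+1 of the sets. \<open>less_nat_ceiling_divide_iff\<close>
  supplies the inequality k*d < x and \<open>pierceable_obtain_intersecting_subfamily\<close> the
  pigeonhole.\<close>

lemma piercing_number_less_iff:
  "piercing_number H < enat n \<longleftrightarrow> (\<exists>k<n. pierceable k H)"
  unfolding piercing_number_def by (auto simp: INF_less_iff)

text \<open>An integer lies below the ceiling of a real exactly when it lies below the real itself;
  clearing the denominator then gives the product form used for counting.\<close>

lemma less_nat_ceiling_divide_iff:
  assumes "d > 0"
  shows "k < nat \<lceil>real x / real d\<rceil> \<longleftrightarrow> k * d < x"
proof -
  have "k < nat \<lceil>real x / real d\<rceil> \<longleftrightarrow> real k < real x / real d"
    by (simp add: zless_nat_eq_int_zless less_ceiling_iff)
  also have "\<dots> \<longleftrightarrow> real (k * d) < real x"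
    using assms by (simp add: pos_less_divide_eq)
  finally show ?thesis
    by (simp only: of_nat_less_iff)
qed

text \<open>At most \<open>k\<close> blocks of at most \<open>d\<close> sets each cannot cover more
  than \<open>k * d\<close> sets, so some block has \<open>d + 1\<close> members.\<close>

lemma pierceable_obtain_intersecting_subfamily:
  assumes "pierceable k G" and "k * d < card G"
  obtains G' where "G' \<subseteq> G" "finite G'" "card G' = Suc d" "\<Inter>G' \<noteq> {}"
proof -
  obtain P where P: "partition_on G P" "finite P" "card P \<le> k" "\<forall>B\<in>P. \<Inter>B \<noteq> {}"
    using assms(1) unfolding pierceable_def by blast
  have "\<exists>B\<in>P. d < card B"
  proof (rule ccontr)
    assume "\<not> (\<exists>B\<in>P. d < card B)"
    then have "(\<Sum>B\<in>P. card B) \<le> card P * d"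
      using sum_bounded_above[of P card d] by (simp add: not_less)
    \<comment> \<open>An infinite block does no harm: \<open>G\<close> would then be infinite too,
      with \<open>card G\<close> equal to 0.\<close>
    moreover have "card G \<le> (\<Sum>B\<in>P. card B)"
      using card_Union_le_sum_card[of P] partition_onD1[OF P(1)] by simp
    moreover have "card P * d \<le> k * d"
      using P(3) by simp
    ultimately show False
      using assms(2) by linarith
  qed
  then obtain B where B: "B \<in> P" "Suc d \<le> card B"
    by auto
  obtain G' where G': "G' \<subseteq> B" "card G' = Suc d" "finite G'"
    using obtain_subset_with_card_n[OF B(2)] by blast
  moreover have "B \<subseteq> G"
    using partition_onD1[OF P(1)] B(1) by blast
  \<comment> \<open>Passing to a subfamily keeps the common point of the block.\<close>
  moreover have "\<Inter>G' \<noteq> {}"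
    using Inter_anti_mono[OF G'(1)] P(4) B(1) by blast
  ultimately show thesis
    using that by blast
qed

theorem theorem1p2:
  fixes F :: "(real ^ 'n) set set" and x :: nat
  assumes "x \<ge> CARD('n) + 1"
    and "compact_convex_family F"
    and "\<And>F'. F' \<subseteq> F \<Longrightarrow> card F' = x \<Longrightarrow>
           piercing_number F' < enat (nat \<lceil>real x / real CARD('n)\<rceil>)"
  shows "piercing_number F \<le> max_piercing x (CARD('n) + 1) TYPE('n)"
proof -
  have "pq_property x (CARD('n) + 1) F"
    unfolding pq_property_def
  proof (intro allI impI)
    fix G assume G: "G \<subseteq> F" "finite G \<and> card G = x"
    then obtain k where "k < nat \<lceil>real x / real CARD('n)\<rceil>" "pierceable k G"
      using assms(3) piercing_number_less_iff by blast
    then have "pierceable k G" "k * CARD('n) < card G"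
      using G(2) by (simp_all add: less_nat_ceiling_divide_iff)
    then show "\<exists>G'\<subseteq>G. finite G' \<and> card G' = CARD('n) + 1 \<and> \<Inter>G' \<noteq> {}"
      by (rule pierceable_obtain_intersecting_subfamily) auto
  qed
  \<comment> \<open>\<open>F\<close> is now itself a member of the index set of the
    supremum.\<close>
  then show ?thesis
    unfolding max_piercing_def using assms(2) by (intro SUP_upper) simp
qed

end
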